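(* The worst-case approximation ratio of Reverse Sequential PAV with respect to the PAV score is $0$; that is, $\inf_E \frac{\operatorname{PAV}(\mathcal R(E))}{\operatorname{OPT}_k}=0$, where $\mathcal R$ denotes Reverse Sequential PAV and the infimum ranges over all elections $E=(N,C,A,k)$.
   Context: An election is a tuple $E=(N,C,A,k)$, where $N=\{1,\ldots,n\}$ is a set of voters, $C$ is a set of $m$ candidates, $A=(A_i)_{i\in N}$ is a profile of approval ballots $A_i\subseteq C$, and $k$ is the desired committee size. It is assumed that $1\le k<m$ and that $A_i\ne\emptyset$ for at least one voter $i$. A committee is a set $W\subseteq C$ with $|W|=k$. For an integer $t\ge 0$, $H(t)=\sum_{j=1}^{t}1/j$ (so $H(0)=0$). For $S\subseteq C$, $\operatorname{PAV}(S)=\sum_{i\in N}H(|A_i\cap S|)$, and for $c\in S$ the marginal loss is $\Delta_S(c)=\operatorname{PAV}(S)-\operatorname{PAV}(S\setminus\{c\})$. $\operatorname{OPT}_k$ is the maximum of $\operatorname{PAV}(W)$ over all committees $W\subseteq C$ with $|W|=k$. Reverse Sequential PAV: let $C_m=C$; for $s=m,m-1,\ldots,k+1$ pick $c_s\in\arg\min_{c\in C_s}\Delta_{C_s}(c)$ and set $C_{s-1}=C_s\setminus\{c_s\}$; return $\mathcal R(E)=C_k$. Ties are resolved using a fixed priority (linear) order on candidates. *)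

theory Defs
  imports "HOL-Analysis.Harmonic_Numbers"
begin

text \<open>The voters are \<open>{1..num_voters E}\<close>; ballots at other indices are never inspected.\<close>

record 'c election =
  num_voters :: nat
  cands :: "'c set"
  ballot :: "nat \<Rightarrow> 'c set"
  committee_size :: nat

definition is_election :: "'c election \<Rightarrow> bool" where
  "is_election E \<longleftrightarrow>
     finite (cands E) \<and>
     (\<forall>i\<in>{1..num_voters E}. ballot E i \<subseteq> cands E) \<and>
     1 \<le> committee_size E \<and> committee_size E < card (cands E) \<and>
     (\<exists>i\<in>{1..num_voters E}. ballot E i \<noteq> {})"

definition committees :: "'c election \<Rightarrow> 'c set set" where
  "committees E = {W. W \<subseteq> cands E \<and> card W = committee_size E}"

definition pav :: "'c election \<Rightarrow> 'c set \<Rightarrow> real" where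
  "pav E S = (\<Sum>i\<in>{1..num_voters E}. harm (card (ballot E i \<inter> S)))"

definition marginal_loss :: "'c election \<Rightarrow> 'c set \<Rightarrow> 'c \<Rightarrow> real" where
  "marginal_loss E S c = pav E S - pav E (S - {c})"

definition opt_pav :: "'c election \<Rightarrow> real" where
  "opt_pav E = Max (pav E ` committees E)"

definition least_loss :: "'c election \<Rightarrow> 'c set \<Rightarrow> 'c set" where
  "least_loss E S = {c. is_arg_min (marginal_loss E S) (\<lambda>c. c \<in> S) c}"

text \<open>
  Among tied candidates the \<open>prio\<close>-least one is removed. As \<open>prio\<close> ranges over all linear
  orders, the opposite reading of ``priority'' is covered by the converse order.
\<close>

definition removed :: "'c rel \<Rightarrow> 'c election \<Rightarrow> 'c set \<Rightarrow> 'c" where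
  "removed prio E S =
     (THE c. c \<in> least_loss E S \<and> (\<forall>d\<in>least_loss E S. (c, d) \<in> prio))"

definition rev_seq_pav :: "'c rel \<Rightarrow> 'c election \<Rightarrow> 'c set" where
  "rev_seq_pav prio E =
     ((\<lambda>S. S - {removed prio E S}) ^^ (card (cands E) - committee_size E)) (cands E)"

end

theory Submission
  imports Defs
begin

text \<open>
  For committee size \<open>1\<close>, take a candidate \<open>c\<close> together with \<open>g\<^sup>2\<close> others, split into \<open>g\<close> blocks
  of size \<open>g\<close>. Each block has one voter approving exactly \<open>c\<close> and the block, and each candidate
  other than \<open>c\<close> has one voter approving it alone. Initially \<open>c\<close> has marginal loss
  \<open>g / (g + 1) < 1\<close>, whereas the lone voter makes every other loss exceed \<open>1\<close>; hence \<open>c\<close> is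
  removed first. The surviving candidate has PAV score \<open>2\<close>, while \<open>c\<close> has score \<open>g\<close>.
\<close>

section \<open>Tie-breaking and the removal process\<close>

lemma linear_order_finite_least:
  assumes "linear_order r" "finite A" "A \<noteq> {}"
  shows "\<exists>c\<in>A. \<forall>d\<in>A. (c, d) \<in> r"
  using assms(2,3)
proof (induction rule: finite_ne_induct)
  case (singleton x)
  then show ?case
    using assms(1) by (simp add: linear_order_on_def partial_order_on_def preorder_on_def refl_on_def)
next
  case (insert x F)
  then obtain c where c: "c \<in> F" "\<forall>d\<in>F. (c, d) \<in> r"
    by blast
  have trans: "trans r" and refl: "(x, x) \<in> r"
    using assms(1) by (simp_all add: linear_order_on_def partial_order_on_def preorder_on_def refl_on_def)
  have "(x, c) \<in> r \<or> (c, x) \<in> r"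
    using assms(1) refl by (cases "x = c") (auto simp: linear_order_on_def total_on_def)
  then show ?case
    using c refl trans by (metis insert_iff transD)
qed

text \<open>Makes the \<open>THE\<close> in \<open>removed\<close> meaningful: a minimiser exists
  because \<open>S\<close> is finite and nonempty, the \<open>prio\<close>-least one exists by
  linearity, and antisymmetry makes it unique.\<close>

lemma removed_in_least_loss:
  assumes "linear_order prio" "finite S" "S \<noteq> {}"
  shows "removed prio E S \<in> least_loss E S"
proof -
  have sub: "least_loss E S \<subseteq> S"
    by (auto simp: least_loss_def is_arg_min_def)
  moreover have "least_loss E S \<noteq> {}"
    using ex_is_arg_min_if_finite[OF assms(2,3), of "marginal_loss E S"]
    by (auto simp: least_loss_def)
  ultimately obtain c where c: "c \<in> least_loss E S" "\<forall>d\<in>least_loss E S. (c, d) \<in> prio"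
    using linear_order_finite_least[OF assms(1)] assms(2) finite_subset by metis
  have "antisym prio"
    using assms(1) by (simp add: linear_order_on_def partial_order_on_def)
  then have "removed prio E S = c"
    unfolding removed_def using c by (intro the_equality) (auto dest: antisymD)
  then show ?thesis
    using c by simp
qed

lemma removed_in:
  assumes "linear_order prio" "finite S" "S \<noteq> {}"
  shows "removed prio E S \<in> S"
  using removed_in_least_loss[OF assms, of E] by (simp add: least_loss_def is_arg_min_def)

lemma funpow_removed_subset:
  "((\<lambda>S. S - {removed prio E S}) ^^ n) S \<subseteq> S"
  by (induction n) auto

lemma card_funpow_removed:
  assumes "linear_order prio" "finite S" "n \<le> card S"
  shows "card (((\<lambda>S. S - {removed prio E S}) ^^ n) S) = card S - n"
  using assms(3)
proof (induction n)
  case (Suc n)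
  let ?T = "((\<lambda>S. S - {removed prio E S}) ^^ n) S"
  have "finite ?T"
    using funpow_removed_subset assms(2) finite_subset by metis
  moreover have "card ?T = card S - n"
    using Suc by simp
  \<comment> \<open>On an empty set \<open>removed\<close> would be an unspecified value;
    \<open>Suc n \<le> card S\<close> keeps a candidate available for this round.\<close>
  moreover from this have "?T \<noteq> {}"
    using Suc.prems by (metis card.empty diff_is_0_eq not_less_eq_eq)
  ultimately show ?case
    using removed_in[OF assms(1), of ?T E] by simp
qed simp

lemma rev_seq_pav_in_committees:
  assumes "linear_order prio" "is_election E"
  shows "rev_seq_pav prio E \<in> committees E"
  using assms card_funpow_removed[OF assms(1), of "cands E" _ E] funpow_removed_subset
  by (fastforce simp: committees_def rev_seq_pav_def is_election_def)

lemma rev_seq_pav_subset: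
  assumes "committee_size E < card (cands E)"
  shows "rev_seq_pav prio E \<subseteq> cands E - {removed prio E (cands E)}"
proof -
  obtain n where "card (cands E) - committee_size E = Suc n"
    using assms by (metis Suc_diff_Suc)
  \<comment> \<open>\<open>funpow_Suc_right\<close> exposes the innermost application, which is the
    first removal; all later rounds only shrink the set.\<close>
  then show ?thesis
    using funpow_removed_subset
    by (simp add: rev_seq_pav_def funpow_Suc_right del: funpow.simps)
qed

section \<open>PAV scores and marginal losses\<close>

lemma pav_nonneg: "0 \<le> pav E S"
  unfolding pav_def by (intro sum_nonneg harm_nonneg)

lemma pav_le_opt_pav:
  assumes "is_election E" "W \<in> committees E"
  shows "pav E W \<le> opt_pav E"
proof -
  have "finite (committees E)"
    using assms(1) by (simp add: committees_def is_election_def)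
  then show ?thesis
    using assms(2) by (simp add: opt_pav_def)
qed

lemma pav_singleton:
  "pav E {x} = card {i \<in> {1..num_voters E}. x \<in> ballot E i}"
proof -
  have "harm (card (B \<inter> {x})) = (if x \<in> B then 1 else 0 :: real)" for B :: "'a set"
    by (simp add: harm_def)
  then show ?thesis
    by (simp add: pav_def sum.If_cases Int_def)
qed

text \<open>Removing \<open>c\<close> lowers the count of each approving voter from some
  \<open>t\<close> to \<open>t - 1\<close>, which costs \<open>H(t) - H(t - 1) = 1/t\<close>; other
  voters lose nothing.\<close>

lemma marginal_loss_eq:
  assumes "finite S" "c \<in> S"
  shows "marginal_loss E S c =
    (\<Sum>i\<in>{i \<in> {1..num_voters E}. c \<in> ballot E i}. 1 / card (ballot E i \<inter> S))"
proof -
  have "harm (card (B \<inter> S)) - harm (card (B \<inter> (S - {c}))) =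
      (if c \<in> B then 1 / card (B \<inter> S) else 0 :: real)" for B
  proof (cases "c \<in> B")
    case True
    then have "B \<inter> S = insert c (B \<inter> (S - {c}))"
      using assms(2) by auto
    then have "card (B \<inter> S) = Suc (card (B \<inter> (S - {c})))"
      using assms(1) by (metis DiffE IntD2 card_insert_disjoint finite_Diff finite_Int insertI1)
    then show ?thesis
      using True by (simp add: harm_Suc divide_inverse)
  next
    case False
    then have "B \<inter> (S - {c}) = B \<inter> S"
      by auto
    then show ?thesis
      using False by simp
  qed
  then show ?thesis
    by (simp add: marginal_loss_def pav_def flip: sum_subtractf sum.inter_filter)
qed

section \<open>The block elections\<close>

text \<open>
  The candidate \<open>c\<close> is \<open>f 0\<close>, voter \<open>i \<in> {1..g * g}\<close> is the lone voter of \<open>f i\<close>, and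
  the last \<open>g\<close> voters are those of the blocks.
\<close>

definition block_election :: "(nat \<Rightarrow> 'c) \<Rightarrow> nat \<Rightarrow> 'c election" where
  "block_election f g =
     \<lparr>num_voters = g * g + g,
      cands = f ` {0..g * g},
      ballot = (\<lambda>i. if i \<le> g * g then {f i}
                    else f ` insert 0 {(i - g * g - 1) * g<..(i - g * g) * g}),
      committee_size = 1\<rparr>"

context
  fixes f :: "nat \<Rightarrow> 'c" and g :: nat
  assumes inj: "inj f" and g: "g > 0"
begin

lemma block_ballot_subset:
  assumes "i \<in> {1..g * g + g}"
  shows "ballot (block_election f g) i \<subseteq> cands (block_election f g)"
proof -
  \<comment> \<open>For lone voters the truncated difference is \<open>0\<close>, so the bound
    covers all voters.\<close>
  have "(i - g * g) * g \<le> g * g"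
    using assms by (intro mult_right_mono) auto
  then have "{(i - g * g - 1) * g<..(i - g * g) * g} \<subseteq> {0..g * g}"
    by (meson atLeastAtMost_iff greaterThanAtMost_iff le0 order_trans subsetI)
  then show ?thesis
    using assms by (auto simp: block_election_def)
qed

lemma block_cands_other:
  assumes "x \<in> cands (block_election f g)" "x \<noteq> f 0"
  obtains l where "x = f l" "l \<in> {1..g * g}"
proof -
  obtain l where "x = f l" "l \<le> g * g"
    using assms by (auto simp: block_election_def)
  moreover from this have "l \<noteq> 0"
    using assms by metis
  ultimately show ?thesis
    by (intro that) auto
qed

lemma is_election_block: "is_election (block_election f g)"
proof -
  have "1 < card (f ` {0..g * g})"
    using g inj by (simp add: card_image inj_on_subset)
  moreover have "f 1 \<in> ballot (block_election f g) 1" "1 \<in> {1..g * g + g}"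
    using g by (simp_all add: block_election_def Suc_leI)
  ultimately show ?thesis
    unfolding is_election_def using block_ballot_subset
    by (auto simp: block_election_def)
qed

lemma voters_of_centre:
  "{i \<in> {1..num_voters (block_election f g)}. f 0 \<in> ballot (block_election f g) i}
     = {g * g<..g * g + g}"
  using inj g by (auto simp: block_election_def inj_eq)

lemma marginal_loss_centre:
  "marginal_loss (block_election f g) (cands (block_election f g)) (f 0) < 1"
proof -
  let ?E = "block_election f g"
  have "card (ballot ?E i \<inter> cands ?E) = Suc g" if i: "i \<in> {g * g<..g * g + g}" for i
  proof -
    \<comment> \<open>Counting blocks from \<open>0\<close> removes the truncated subtractions:
      block \<open>j\<close> is \<open>{j * g<..Suc j * g}\<close>, which has \<open>g\<close>
      elements and omits \<open>0\<close>.\<close>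
    obtain j where j: "i = g * g + Suc j"
      using i by (metis greaterThanAtMost_iff less_imp_Suc_add add_Suc_right)
    have "ballot ?E i \<inter> cands ?E = ballot ?E i"
      using block_ballot_subset i by (intro Int_absorb2) auto
    also have "card \<dots> = card (insert 0 {j * g<..Suc j * g})"
      by (simp add: block_election_def j card_image[OF inj_on_subset[OF inj subset_UNIV]]
          del: image_insert)
    finally show ?thesis
      by simp
  qed
  then have "(\<Sum>i\<in>{g * g<..g * g + g}. 1 / card (ballot ?E i \<inter> cands ?E))
      = (\<Sum>i\<in>{g * g<..g * g + g}. 1 / real (Suc g))"
    by (intro sum.cong) auto
  moreover have "finite (cands ?E)" "f 0 \<in> cands ?E"
    by (auto simp: block_election_def)
  ultimately show ?thesis
    by (simp only: marginal_loss_eq voters_of_centre) simp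
qed

lemma marginal_loss_other:
  assumes "l \<in> {1..g * g}"
  shows "marginal_loss (block_election f g) (cands (block_election f g)) (f l) \<ge> 1"
proof -
  let ?E = "block_election f g"
  let ?V = "{i \<in> {1..num_voters ?E}. f l \<in> ballot ?E i}"
  have "ballot ?E l \<inter> cands ?E = {f l}" and l: "l \<in> ?V"
    using assms by (auto simp: block_election_def)
  then have "1 = 1 / real (card (ballot ?E l \<inter> cands ?E))"
    by simp
  \<comment> \<open>The term of the lone voter \<open>l\<close> already equals 1, and the terms of
    block voters are nonnegative.\<close>
  also have "\<dots> \<le> (\<Sum>i\<in>?V. 1 / card (ballot ?E i \<inter> cands ?E))"
    using l by (intro member_le_sum) auto
  also have "\<dots> = marginal_loss ?E (cands ?E) (f l)"
    using assms by (intro marginal_loss_eq[symmetric]) (auto simp: block_election_def)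
  finally show ?thesis .
qed

lemma removed_block:
  assumes "linear_order prio"
  shows "removed prio (block_election f g) (cands (block_election f g)) = f 0"
proof (rule ccontr)
  let ?E = "block_election f g"
  let ?r = "removed prio ?E (cands ?E)"
  assume "?r \<noteq> f 0"
  have "?r \<in> least_loss ?E (cands ?E)"
    by (rule removed_in_least_loss[OF assms]) (simp_all add: block_election_def)
  then have "?r \<in> cands ?E"
    and "\<not> marginal_loss ?E (cands ?E) (f 0) < marginal_loss ?E (cands ?E) ?r"
    by (auto simp: least_loss_def is_arg_min_def block_election_def)
  moreover from this obtain l where "?r = f l" "l \<in> {1..g * g}"
    using \<open>?r \<noteq> f 0\<close> block_cands_other by metis
  ultimately show False
    using marginal_loss_centre marginal_loss_other[of l] by simp
qed

lemma pav_other: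
  assumes "l \<in> {1..g * g}"
  shows "pav (block_election f g) {f l} \<le> 2"
proof -
  let ?E = "block_election f g"
  let ?V = "{i \<in> {1..num_voters ?E}. f l \<in> ballot ?E i}"
  \<comment> \<open>Apart from its lone voter, \<open>f l\<close> is approved only by the voter of
    its own block. The blocks are disjoint intervals open on the left, so the block of
    \<open>l\<close> has index \<open>(l - 1) div g\<close>.\<close>
  have "i = g * g + Suc ((l - 1) div g)" if i: "i \<in> ?V" "i \<noteq> l" for i
  proof -
    have "\<not> i \<le> g * g"
      using i inj by (auto simp: block_election_def inj_eq)
    then obtain j where j: "i = g * g + Suc j"
      by (metis less_imp_Suc_add add_Suc_right not_le)
    then have "j * g < l" "l \<le> Suc j * g"
      using i inj assms by (auto simp: block_election_def inj_eq inj_image_mem_iff)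
    then have "(l - 1) div g = j"
      by (intro div_nat_eqI) (auto simp: algebra_simps)
    then show ?thesis
      using j by simp
  qed
  then have "?V \<subseteq> {l, g * g + Suc ((l - 1) div g)}"
    by blast
  then have "card ?V \<le> card {l, g * g + Suc ((l - 1) div g)}"
    by (intro card_mono) auto
  also have "\<dots> \<le> 2"
    by (simp add: card_insert_if)
  finally show ?thesis
    by (simp add: pav_singleton)
qed

lemma ratio_block:
  assumes "linear_order prio"
  shows "pav (block_election f g) (rev_seq_pav prio (block_election f g))
           / opt_pav (block_election f g) \<le> 2 / g"
proof -
  let ?E = "block_election f g"
  let ?R = "rev_seq_pav prio ?E"
  have "card ?R = 1"
    using rev_seq_pav_in_committees[OF assms is_election_block]
    by (simp add: committees_def block_election_def)
  moreover have "?R \<subseteq> cands ?E - {f 0}"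
    using rev_seq_pav_subset[of ?E prio] is_election_block
    by (simp add: removed_block[OF assms] is_election_def)
  ultimately obtain x where "?R = {x}" "x \<in> cands ?E" "x \<noteq> f 0"
    by (auto simp: card_1_singleton_iff)
  then have "pav ?E ?R \<le> 2"
    using pav_other block_cands_other by metis
  moreover have "real g \<le> opt_pav ?E"
  proof -
    have "{f 0} \<in> committees ?E"
      by (simp add: committees_def block_election_def)
    moreover have "pav ?E {f 0} = g"
      by (simp only: pav_singleton voters_of_centre) simp
    ultimately show ?thesis
      using pav_le_opt_pav[OF is_election_block] by metis
  qed
  ultimately show ?thesis
    using g by (intro frac_le) auto
qed

end

section \<open>The infimum over all elections\<close>

theorem theorem7:
  fixes prio :: "'c rel"
  assumes "infinite (UNIV :: 'c set)"
    and "linear_order prio"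
  shows "(INF E\<in>{E :: 'c election. is_election E}.
            pav E (rev_seq_pav prio E) / opt_pav E) = 0"
proof (rule antisym)
  let ?Es = "{E :: 'c election. is_election E}"
  let ?ratio = "\<lambda>E. pav E (rev_seq_pav prio E) / opt_pav E"
  \<comment> \<open>One injection supplies the candidates for every \<open>g\<close>.\<close>
  obtain f :: "nat \<Rightarrow> 'c" where f: "inj f"
    using assms(1) infinite_countable_subset by blast
  have nonneg: "0 \<le> ?ratio E" if "E \<in> ?Es" for E
  proof -
    \<comment> \<open>The sign of the maximum is read off from one committee, the output of the
      rule.\<close>
    have "0 \<le> opt_pav E"
      using that rev_seq_pav_in_committees[OF assms(2)] pav_le_opt_pav pav_nonneg order_trans
      by blast
    then show ?thesis
      by (simp add: pav_nonneg)
  qed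
  have "block_election f 1 \<in> ?Es"
    using is_election_block[OF f, of 1] by simp
  then have "?Es \<noteq> {}"
    by blast
  then show "0 \<le> (INF E\<in>?Es. ?ratio E)"
    using nonneg by (intro cINF_greatest)
  \<comment> \<open>A real \<open>INF\<close> lies below its members only when the family is bounded
    below. Taking \<open>g = Suc n\<close> then keeps \<open>g\<close> positive.\<close>
  have "bdd_below (?ratio ` ?Es)"
    using nonneg by (intro bdd_belowI2)
  then have le: "(INF E\<in>?Es. ?ratio E) \<le> 2 / Suc n" for n
    using is_election_block[OF f, of "Suc n"] ratio_block[OF f _ assms(2), of "Suc n"]
    by (intro cINF_lower2[where x = "block_election f (Suc n)"]) auto
  have "(\<lambda>n. 2 / real (Suc n)) \<longlonglongrightarrow> 0"
    using tendsto_mult_right_zero[OF LIMSEQ_inverse_real_of_nat, of 2] by (simp add: divide_inverse)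
  then show "(INF E\<in>?Es. ?ratio E) \<le> 0"
    using le by (intro LIMSEQ_le_const) auto
qed

end
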